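(* Let $m_0\ge m_1\ge 1$, let $A_0=\sigma\sigma^*$ be a real symmetric positive semidefinite $m_0\times m_0$ matrix and $B_1$ a real $m_0\times m_1$ matrix of rank $m_1$, and let $(P_t)_{t\ge 0}$ be the semigroup on $\mathbb{R}^{m_0}\times\mathbb{R}^{m_1}$ of the diffusion $dX_1(t)=\sigma\,dB(t)$, $dX_2(t)=B_1^*X_1(t)\,dt$, with carré du champ $\Gamma$. Let $f\in C^1(\mathbb{R}^{m_0}\times\mathbb{R}^{m_1})$ be globally Lipschitz. Then for every $t\ge 0$, $x^{(1)}\in\mathbb{R}^{m_0}$, $x^{(2)}\in\mathbb{R}^{m_1}$, $$2\Gamma(P_tf)(x^{(1)},x^{(2)})\le P_t\left(\left\|\nabla^{(1)}f+tB_1\nabla^{(2)}f\right\|_{A_0}^2\right)(x^{(1)},x^{(2)}),$$ and the following reverse inequality holds: $$2P_t\left(\Gamma(f)\right)(x^{(1)},x^{(2)})\ge\left\|\nabla^{(1)}P_tf(x^{(1)},x^{(2)})-tB_1\nabla^{(2)}P_tf(x^{(1)},x^{(2)})\right\|_{A_0}^2.$$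
   Context: $M^*$ denotes the transpose of a matrix $M$. $\sigma$ is a constant $m_0\times m_0$ matrix with $\sigma\sigma^*=A_0$, and $B(t)$ is a standard Brownian motion in $\mathbb{R}^{m_0}$. The process started at $(x^{(1)},x^{(2)})$ is $\mathbf{X}_t=\left(x^{(1)}+\sigma B(t),\ x^{(2)}+tB_1^*x^{(1)}+\int_0^tB_1^*\sigma B(s)\,ds\right)$ with $B(0)=0$, and $P_tf(x^{(1)},x^{(2)})=\mathbb{E}[f(\mathbf{X}_t)]$ for this starting point. $\nabla^{(1)}f$ and $\nabla^{(2)}f$ are the (column) vectors of partial derivatives of $f$ with respect to the coordinates of $x^{(1)}\in\mathbb{R}^{m_0}$ and of $x^{(2)}\in\mathbb{R}^{m_1}$ respectively. For $v\in\mathbb{R}^{m_0}$, $\|v\|_{A_0}=\sqrt{v^*A_0v}$. With $\mathcal{L}$ the generator of the diffusion, $\Gamma(f,g)=\frac12(\mathcal{L}(fg)-f\mathcal{L}g-g\mathcal{L}f)$ and $\Gamma(f)=\Gamma(f,f)$; explicitly, $\Gamma(f)=\frac12\|\nabla^{(1)}f\|_{A_0}^2$, and this formula is used for all $C^1$ functions $f$. *)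

theory Defs
  imports "HOL-Probability.Probability"
begin

text \<open>
  Standard Brownian motion in Euclidean space, started at the origin. Continuity of paths and the
  initial condition hold for every outcome, so that pathwise time integrals are random variables
  also when \<open>M\<close> is not complete. The increment over \<open>[s, t]\<close> is Gaussian with mean zero and covariance
  matrix \<open>(t - s)\<close> times the identity; \<^const>\<open>normal_density\<close> takes the standard deviation as its
  second argument.
\<close>

locale std_brownian_motion = prob_space M
  for M :: "'w measure" and B :: "real \<Rightarrow> 'w \<Rightarrow> real ^ 'n" +
  assumes start_zero: "\<omega> \<in> space M \<Longrightarrow> B 0 \<omega> = 0"
    and continuous_paths: "\<omega> \<in> space M \<Longrightarrow> continuous_on {0..} (\<lambda>t. B t \<omega>)"
    and independent_increments:
      "0 \<le> \<tau> 0 \<Longrightarrow> strict_mono \<tau> \<Longrightarrow>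
        indep_vars (\<lambda>_. borel) (\<lambda>k \<omega>. B (\<tau> (Suc k)) \<omega> - B (\<tau> k) \<omega>) {..<n::nat}"
    and gaussian_increments:
      "0 \<le> s \<Longrightarrow> s < t \<Longrightarrow>
        distributed M lborel (\<lambda>\<omega>. B t \<omega> - B s \<omega>)
          (\<lambda>y. ennreal (\<Prod>i\<in>UNIV. normal_density 0 (sqrt (t - s)) (y $ i)))"

definition diffusion ::
  "real ^ 'm0 ^ 'm0 \<Rightarrow> real ^ 'm1 ^ 'm0 \<Rightarrow> (real \<Rightarrow> 'w \<Rightarrow> real ^ 'm0) \<Rightarrow>
    (real ^ 'm0) \<times> (real ^ 'm1) \<Rightarrow> real \<Rightarrow> 'w \<Rightarrow> (real ^ 'm0) \<times> (real ^ 'm1)"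
  where "diffusion \<sigma> B1 B x t \<omega> =
    (fst x + \<sigma> *v B t \<omega>,
     snd x + t *\<^sub>R (transpose B1 *v fst x)
       + integral {0..t} (\<lambda>s. transpose B1 *v (\<sigma> *v B s \<omega>)))"

definition diffusion_semigroup ::
  "'w measure \<Rightarrow> real ^ 'm0 ^ 'm0 \<Rightarrow> real ^ 'm1 ^ 'm0 \<Rightarrow> (real \<Rightarrow> 'w \<Rightarrow> real ^ 'm0) \<Rightarrow> real \<Rightarrow>
    ((real ^ 'm0) \<times> (real ^ 'm1) \<Rightarrow> real) \<Rightarrow> (real ^ 'm0) \<times> (real ^ 'm1) \<Rightarrow> real"
  where "diffusion_semigroup M \<sigma> B1 B t f x = (LINT \<omega>|M. f (diffusion \<sigma> B1 B x t \<omega>))"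

definition grad1 ::
  "((real ^ 'm0) \<times> (real ^ 'm1) \<Rightarrow> real) \<Rightarrow> (real ^ 'm0) \<times> (real ^ 'm1) \<Rightarrow> real ^ 'm0"
  where "grad1 f x = (\<chi> i. deriv (\<lambda>h. f (fst x + h *\<^sub>R axis i 1, snd x)) 0)"

definition grad2 ::
  "((real ^ 'm0) \<times> (real ^ 'm1) \<Rightarrow> real) \<Rightarrow> (real ^ 'm0) \<times> (real ^ 'm1) \<Rightarrow> real ^ 'm1"
  where "grad2 f x = (\<chi> j. deriv (\<lambda>h. f (fst x, snd x + h *\<^sub>R axis j 1)) 0)"

definition matrix_seminorm :: "real ^ 'n ^ 'n \<Rightarrow> real ^ 'n \<Rightarrow> real"
  where "matrix_seminorm A v = sqrt (v \<bullet> (A *v v))"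

text \<open>
  The carre du champ \<open>\<Gamma>(f) = \<Gamma>(f, f)\<close>, where \<open>\<Gamma>(f, g) = (L(fg) - f L g - g L f) / 2\<close>. The generator
  \<open>L\<close> consists of the second-order part \<open>(1/2) \<Sum>ij A_ij \<partial>_i \<partial>_j\<close> in the first block of variables,
  with \<open>A = \<sigma> \<sigma>*\<close>, and a drift, to which \<open>\<Gamma>\<close> is insensitive. Evaluating \<open>\<Gamma>\<close> gives the expression
  below, which is taken as the definition because it makes sense for all \<open>C\<^sup>1\<close> functions.
\<close>

definition carre_du_champ ::
  "real ^ 'm0 ^ 'm0 \<Rightarrow> ((real ^ 'm0) \<times> (real ^ 'm1) \<Rightarrow> real) \<Rightarrow>
    (real ^ 'm0) \<times> (real ^ 'm1) \<Rightarrow> real"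
  where "carre_du_champ A f x = (1 / 2) * (matrix_seminorm A (grad1 f x))\<^sup>2"

definition C1_function :: "('a::real_normed_vector \<Rightarrow> real) \<Rightarrow> bool"
  where "C1_function f \<longleftrightarrow>
    (\<exists>f'. (\<forall>x. (f has_derivative blinfun_apply (f' x)) (at x)) \<and> continuous_on UNIV f')"

end

theory Submission imports Defs
begin

text \<open>
  The diffusion is linear in its starting point: moving the start by \<open>(u, w)\<close> moves the endpoint,
  for every outcome, by the deterministic vector \<open>(u, w + t B1* u)\<close> (\<open>diffusion_translate\<close>).
  The noise does not interact with the starting point, so derivatives of \<open>P t f\<close> are expectations of
  derivatives of \<open>f\<close> along these moved directions. Writing \<open>Z\<close> for the endpoint, this gives
  (\<open>grad_diffusion_semigroup\<close>)
  \<open>\<nabla>1 (P t f) = E [\<nabla>1 f (Z) + t B1 \<nabla>2 f (Z)]\<close> and \<open>\<nabla>2 (P t f) = E [\<nabla>2 f (Z)]\<close>.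
  Combining the two identities, the term with \<open>\<nabla>2\<close> cancels and
  \<open>\<nabla>1 (P t f) - t B1 \<nabla>2 (P t f) = E [\<nabla>1 f (Z)]\<close>.

  Since \<open>A0 = \<sigma> \<sigma>*\<close>, the squared seminorm \<open>v* A0 v = |\<sigma>* v|\<^sup>2\<close> is convex, and Jensen's inequality
  (\<open>matrix_seminorm_expectation_le\<close>) moves the expectation outside. Applied to the first identity it
  is the gradient bound; applied to the combination it is the reverse inequality.

  The analytic content lies in differentiating under the expectation. The difference quotients of
  \<open>f\<close> are dominated by its Lipschitz constant
  (\<open>has_real_derivative_expectation_translate\<close>), and \<open>f (Z)\<close> is integrable because \<open>f\<close> grows at
  most linearly and \<open>Z\<close> is integrable (\<open>integrable_diffusion\<close>). The latter comes from the second
  moment \<open>E |B s|\<^sup>2 = n s\<close> together with Fubini's theorem for the time integral of the Brownian path.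
\<close>

section \<open>Integrability of the diffusion\<close>

text \<open>
  The coordinates of a standard Gaussian vector are independent, so under the product density a
  function of one coordinate integrates as in dimension one: the remaining factors integrate to 1.
\<close>

lemma nn_integral_gaussian_coordinate:
  fixes g :: "real \<Rightarrow> real" and i :: "'n::finite"
  assumes r: "0 < r" and g[measurable]: "g \<in> borel_measurable borel" and nn: "\<And>x. 0 \<le> g x"
  shows "(\<integral>\<^sup>+y. ennreal (\<Prod>j\<in>UNIV. normal_density 0 r (y $ j)) * ennreal (g (y $ i))
             \<partial>(lborel :: (real ^ 'n) measure))
         = (\<integral>\<^sup>+x. ennreal (normal_density 0 r x * g x) \<partial>lborel)"
proof -
  \<comment> \<open>The factors, indexed by basis vectors, in the form in which the product integral factorises;
      \<open>g\<close> is absorbed into the \<open>i\<close>-th factor.\<close>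
  define h where "h b x = ennreal (normal_density 0 r x * (if b = axis i 1 then g x else 1))"
    for b :: "real ^ 'n" and x :: real
  have inj: "inj (\<lambda>j::'n. axis j (1::real))"
    by (auto simp: inj_on_def axis_eq_axis)
  have Basis_eq: "Basis = range (\<lambda>j::'n. axis j (1::real))"
    by (auto simp: Basis_vec_def)
  have one: "(\<integral>\<^sup>+x. ennreal (normal_density 0 r x) \<partial>lborel) = 1"
    using r by (subst nn_integral_eq_integral) auto
  have h_meas: "h b \<in> borel_measurable borel" for b
    unfolding h_def by (cases "b = axis i 1") auto
  have "ennreal (\<Prod>j\<in>UNIV. normal_density 0 r (y $ j)) * ennreal (g (y $ i))
      = (\<Prod>b\<in>Basis. h b (y \<bullet> b))" for y :: "real ^ 'n"
  proof -
    have "(\<Prod>b\<in>Basis. h b (y \<bullet> b)) = (\<Prod>j\<in>UNIV. h (axis j 1) (y \<bullet> axis j 1))"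
      unfolding Basis_eq using inj by (subst prod.reindex) auto
    also have "\<dots> = (\<Prod>j\<in>UNIV. ennreal (normal_density 0 r (y $ j) * (if j = i then g (y $ j) else 1)))"
      by (simp add: h_def axis_eq_axis inner_axis)
    also have "\<dots> = ennreal ((\<Prod>j\<in>UNIV. normal_density 0 r (y $ j)) * (\<Prod>j\<in>UNIV. if j = i then g (y $ j) else 1))"
      by (subst prod_ennreal) (auto simp: nn prod.distrib)
    also have "(\<Prod>j\<in>UNIV. if j = i then g (y $ j) else 1) = g (y $ i)"
      by simp
    finally show ?thesis
      by (simp add: ennreal_mult nn prod_nonneg)
  qed
  then have "(\<integral>\<^sup>+y. ennreal (\<Prod>j\<in>UNIV. normal_density 0 r (y $ j)) * ennreal (g (y $ i))
        \<partial>(lborel :: (real ^ 'n) measure)) = (\<Prod>b\<in>Basis. \<integral>\<^sup>+x. h b x \<partial>lborel)"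
    by (simp add: nn_integral_lborel_prod h_meas)
  also have "\<dots> = (\<Prod>j\<in>UNIV. \<integral>\<^sup>+x. h (axis j 1) x \<partial>lborel)"
    unfolding Basis_eq using inj by (subst prod.reindex) auto
  also have "\<dots> = (\<Prod>j\<in>UNIV. if j = i then (\<integral>\<^sup>+x. ennreal (normal_density 0 r x * g x) \<partial>lborel) else 1)"
    by (intro prod.cong) (auto simp: h_def axis_eq_axis one)
  finally show ?thesis by simp
qed

lemma nn_integral_gaussian_second_moment:
  assumes r: "0 < r"
  shows "(\<integral>\<^sup>+y. ennreal (\<Prod>j\<in>UNIV. normal_density 0 r (y $ j)) * ennreal ((norm y)\<^sup>2)
             \<partial>(lborel :: (real ^ 'n) measure)) = ennreal (real CARD('n) * r\<^sup>2)"
proof -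
  have m: "(\<integral>\<^sup>+x. ennreal (normal_density 0 r x * x\<^sup>2) \<partial>lborel) = ennreal (r\<^sup>2)"
    using integral_normal_moment_even[OF r, of 0 1] integrable_normal_moment[OF r, of 0 2] r
    by (subst nn_integral_eq_integral) auto
  have sq: "ennreal ((norm y)\<^sup>2) = (\<Sum>i\<in>UNIV. ennreal ((y $ i)\<^sup>2))" for y :: "real ^ 'n"
    by (simp add: norm_vec_def L2_set_def sum_nonneg)
  have "(\<integral>\<^sup>+y. ennreal (\<Prod>j\<in>UNIV. normal_density 0 r (y $ j)) * ennreal ((norm y)\<^sup>2)
             \<partial>(lborel :: (real ^ 'n) measure))
      = (\<Sum>i\<in>UNIV. \<integral>\<^sup>+y. ennreal (\<Prod>j\<in>UNIV. normal_density 0 r (y $ j)) * ennreal ((y $ i)\<^sup>2)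
             \<partial>(lborel :: (real ^ 'n) measure))"
    unfolding sq sum_distrib_left by (subst nn_integral_sum) auto
  also have "\<dots> = (\<Sum>i\<in>(UNIV :: 'n set). ennreal (r\<^sup>2))"
    by (intro sum.cong refl)
      (subst nn_integral_gaussian_coordinate[OF r, where g = "\<lambda>x. x\<^sup>2"], auto simp: m)
  finally show ?thesis
    by (simp add: ennreal_mult ennreal_of_nat_eq_real_of_nat)
qed

text \<open>
  Sampling the path at the grid point \<open>\<lfloor>(n + 1) s\<rfloor> / (n + 1)\<close> just below \<open>s\<close> involves only countably
  many random variables, hence is jointly measurable in time and outcome; continuity of the paths
  lets these approximations converge to the process.
\<close>

lemma borel_measurable_continuous_process:
  fixes X :: "real \<Rightarrow> 'w \<Rightarrow> 'b::metric_space"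
  assumes meas: "\<And>s. X s \<in> borel_measurable M"
    and cont: "\<And>\<omega>. \<omega> \<in> space M \<Longrightarrow> continuous_on UNIV (\<lambda>s. X s \<omega>)"
  shows "(\<lambda>(s, \<omega>). X s \<omega>) \<in> borel_measurable ((borel :: real measure) \<Otimes>\<^sub>M M)"
proof -
  define d where "d n s = real_of_int \<lfloor>real (Suc n) * s\<rfloor> / real (Suc n)" for n s
  have d_lim: "(\<lambda>n. d n s) \<longlonglongrightarrow> s" for s
  proof (rule LIMSEQ_I)
    fix e :: real assume "0 < e"
    then obtain N where N: "inverse (real (Suc N)) < e"
      using reals_Archimedean by blast
    have "norm (d n s - s) < e" if "N \<le> n" for n
    proof -
      have "d n s - s = (real_of_int \<lfloor>real (Suc n) * s\<rfloor> - real (Suc n) * s) / real (Suc n)"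
        unfolding d_def by (simp add: field_simps del: of_nat_Suc)
      also have "\<bar>\<dots>\<bar> \<le> 1 / real (Suc n)"
        unfolding abs_divide by (intro frac_le) linarith+
      also have "\<dots> \<le> inverse (real (Suc N))"
        using that by (simp add: field_simps)
      finally show ?thesis using N by simp
    qed
    then show "\<exists>N. \<forall>n\<ge>N. norm (d n s - s) < e" by blast
  qed
  have "(\<lambda>p. X (d n (fst p)) (snd p)) \<in> borel_measurable ((borel :: real measure) \<Otimes>\<^sub>M M)" for n
    unfolding d_def
    by (rule measurable_compose_countable[where f = "\<lambda>k p. X (real_of_int k / real (Suc n)) (snd p)"])
      (auto intro: measurable_compose[OF measurable_snd meas])
  then have "(\<lambda>p. X (fst p) (snd p)) \<in> borel_measurable ((borel :: real measure) \<Otimes>\<^sub>M M)"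
  proof (rule borel_measurable_LIMSEQ_metric)
    fix p assume "p \<in> space ((borel :: real measure) \<Otimes>\<^sub>M M)"
    then have "isCont (\<lambda>s. X s (snd p)) (fst p)"
      using cont by (auto simp: space_pair_measure continuous_on_eq_continuous_at)
    then show "(\<lambda>n. X (d n (fst p)) (snd p)) \<longlonglongrightarrow> X (fst p) (snd p)"
      using d_lim by (rule isCont_tendsto_compose)
  qed
  then show ?thesis by (simp add: case_prod_beta)
qed

context std_brownian_motion
begin

lemma borel_measurable_brownian:
  assumes "0 \<le> s"
  shows "B s \<in> borel_measurable M"
proof (cases "s = 0")
  case True
  then show ?thesis
    by (subst measurable_cong[where g = "\<lambda>_. 0"]) (auto simp: start_zero)
next
  case False
  then have "(\<lambda>\<omega>. B s \<omega> - B 0 \<omega>) \<in> borel_measurable M"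
    using distributed_measurable[OF gaussian_increments[of 0 s]] assms by simp
  then show ?thesis
    by (subst measurable_cong[where g = "\<lambda>\<omega>. B s \<omega> - B 0 \<omega>"]) (auto simp: start_zero)
qed

lemma second_moment_brownian:
  assumes "0 \<le> s"
  shows "(\<integral>\<^sup>+\<omega>. ennreal ((norm (B s \<omega>))\<^sup>2) \<partial>M) = ennreal (real CARD('n) * s)"
proof (cases "s = 0")
  case True
  have "(\<integral>\<^sup>+\<omega>. ennreal ((norm (B s \<omega>))\<^sup>2) \<partial>M) = (\<integral>\<^sup>+\<omega>. 0 \<partial>M)"
    by (intro nn_integral_cong) (simp add: True start_zero)
  then show ?thesis by (simp add: True)
next
  case False
  have "(\<integral>\<^sup>+\<omega>. ennreal ((norm (B s \<omega>))\<^sup>2) \<partial>M)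
      = (\<integral>\<^sup>+\<omega>. ennreal ((norm (B s \<omega> - B 0 \<omega>))\<^sup>2) \<partial>M)"
    by (intro nn_integral_cong) (simp add: start_zero)
  also have "\<dots> = ennreal (real CARD('n) * (sqrt (s - 0))\<^sup>2)"
    using False assms
    by (subst distributed_nn_integral[OF gaussian_increments[of 0 s], symmetric])
      (auto simp: nn_integral_gaussian_second_moment)
  finally show ?thesis using assms by simp
qed

lemma nn_integral_norm_brownian_le:
  assumes "0 \<le> s"
  shows "(\<integral>\<^sup>+\<omega>. ennreal (norm (B s \<omega>)) \<partial>M) \<le> ennreal (1 + real CARD('n) * s)"
proof -
  note [measurable] = borel_measurable_brownian[OF assms]
  have le: "r \<le> 1 + r\<^sup>2" for r :: real
    using sum_squares_bound[of r 1] zero_le_power2[of r] unfolding one_power2 by linarith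
  have "(\<integral>\<^sup>+\<omega>. ennreal (norm (B s \<omega>)) \<partial>M) \<le> (\<integral>\<^sup>+\<omega>. 1 + ennreal ((norm (B s \<omega>))\<^sup>2) \<partial>M)"
  proof (rule nn_integral_mono)
    fix \<omega>
    have "ennreal (norm (B s \<omega>)) \<le> ennreal (1 + (norm (B s \<omega>))\<^sup>2)"
      by (intro ennreal_leI le)
    then show "ennreal (norm (B s \<omega>)) \<le> 1 + ennreal ((norm (B s \<omega>))\<^sup>2)"
      by (simp add: ennreal_plus)
  qed
  also have "\<dots> = 1 + ennreal (real CARD('n) * s)"
    by (subst nn_integral_add) (auto simp: second_moment_brownian assms emeasure_space_1)
  also have "\<dots> = ennreal (1 + real CARD('n) * s)"
    using assms by (simp add: ennreal_plus)
  finally show ?thesis .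
qed

lemma integrable_brownian:
  assumes "0 \<le> s"
  shows "integrable M (B s)"
proof (rule integrableI_bounded)
  show "(\<integral>\<^sup>+\<omega>. ennreal (norm (B s \<omega>)) \<partial>M) < \<infinity>"
    using nn_integral_norm_brownian_le[OF assms] by (rule le_less_trans) simp
qed (use assms in \<open>rule borel_measurable_brownian\<close>)

text \<open>
  The process is extended to negative times by \<open>B (max 0 s)\<close>, which keeps its paths continuous on the
  whole line, so that joint measurability is available and Fubini's theorem applies on \<open>[0, t]\<close>: the
  expected norm is at most \<open>1 + n t\<close> there. Measurability of the integral in the outcome is part of
  what Fubini's theorem yields.
\<close>

lemma integrable_time_integral_brownian:
  assumes "0 \<le> t"
  shows "integrable M (\<lambda>\<omega>. integral {0..t} (\<lambda>s. B s \<omega>))"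
proof -
  interpret pair_sigma_finite lborel M ..
  have joint[measurable]: "(\<lambda>(s, \<omega>). B (max 0 s) \<omega>) \<in> borel_measurable (borel \<Otimes>\<^sub>M M)"
  proof (rule borel_measurable_continuous_process)
    fix \<omega> assume "\<omega> \<in> space M"
    then show "continuous_on UNIV (\<lambda>s. B (max 0 s) \<omega>)"
      by (intro continuous_on_compose2[OF continuous_paths]) (auto intro!: continuous_intros)
  qed (simp add: borel_measurable_brownian)
  have "integrable (lborel \<Otimes>\<^sub>M M) (\<lambda>(s, \<omega>). indicator {0..t} s *\<^sub>R B (max 0 s) \<omega>)" (is "integrable _ ?I")
  proof (rule integrableI_bounded)
    show meas: "?I \<in> borel_measurable (lborel \<Otimes>\<^sub>M M)"
      by measurable
    have "(\<integral>\<^sup>+p. ennreal (norm (?I p)) \<partial>(lborel \<Otimes>\<^sub>M M))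
        = (\<integral>\<^sup>+s. \<integral>\<^sup>+\<omega>. ennreal (norm (?I (s, \<omega>))) \<partial>M \<partial>lborel)"
      using meas by (intro sigma_finite_measure.nn_integral_fst[of M, symmetric]) (unfold_locales, simp)
    also have "\<dots> \<le> (\<integral>\<^sup>+s. ennreal (1 + real CARD('n) * t) * indicator {0..t} s \<partial>lborel)"
    proof (rule nn_integral_mono)
      fix s
      show "(\<integral>\<^sup>+\<omega>. ennreal (norm (?I (s, \<omega>))) \<partial>M)
          \<le> ennreal (1 + real CARD('n) * t) * indicator {0..t} s"
      proof (cases "s \<in> {0..t}")
        case True
        then have "(\<integral>\<^sup>+\<omega>. ennreal (norm (?I (s, \<omega>))) \<partial>M) = (\<integral>\<^sup>+\<omega>. ennreal (norm (B s \<omega>)) \<partial>M)"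
          by (simp add: max_def)
        also have "\<dots> \<le> ennreal (1 + real CARD('n) * s)"
          using True by (intro nn_integral_norm_brownian_le) simp
        also have "\<dots> \<le> ennreal (1 + real CARD('n) * t)"
          using True by (intro ennreal_leI) (simp add: mult_left_mono)
        finally show ?thesis using True by simp
      qed simp
    qed
    also have "\<dots> < \<infinity>"
      using assms by (simp add: nn_integral_cmult_indicator ennreal_mult_less_top)
    finally show "(\<integral>\<^sup>+p. ennreal (norm (?I p)) \<partial>(lborel \<Otimes>\<^sub>M M)) < \<infinity>" .
  qed
  then have "integrable M (\<lambda>\<omega>. \<integral>s. indicator {0..t} s *\<^sub>R B (max 0 s) \<omega> \<partial>lborel)"
    by (rule integrable_snd)
  moreover have "(\<integral>s. indicator {0..t} s *\<^sub>R B (max 0 s) \<omega> \<partial>lborel) = integral {0..t} (\<lambda>s. B s \<omega>)"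
    if "\<omega> \<in> space M" for \<omega>
  proof -
    have c: "continuous_on {0..t} (\<lambda>s. B s \<omega>)"
      using continuous_on_subset[OF continuous_paths[OF that]] by auto
    have "(\<integral>s. indicator {0..t} s *\<^sub>R B (max 0 s) \<omega> \<partial>lborel) = (LINT s:{0..t}|lborel. B s \<omega>)"
      unfolding set_lebesgue_integral_def
      by (intro Bochner_Integration.integral_cong) (auto simp: indicator_def)
    also have "\<dots> = integral {0..t} (\<lambda>s. B s \<omega>)"
      by (intro set_borel_integral_eq_integral borel_integrable_atLeastAtMost' c)
    finally show ?thesis .
  qed
  ultimately show ?thesis
    by (simp cong: Bochner_Integration.integrable_cong)
qed

lemma integrable_diffusion:
  assumes t: "0 \<le> t"
  shows "integrable M (diffusion \<sigma> B1 B x t)"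
proof -
  define T where "T v = transpose B1 *v (\<sigma> *v v)" for v
  have T: "bounded_linear T"
    unfolding T_def
    by (intro bounded_linear_compose[OF matrix_vector_mul_bounded_linear]
        matrix_vector_mul_bounded_linear)
  have "integral {0..t} (\<lambda>s. T (B s \<omega>)) = T (integral {0..t} (\<lambda>s. B s \<omega>))"
    if "\<omega> \<in> space M" for \<omega>
  proof -
    have "(\<lambda>s. B s \<omega>) integrable_on {0..t}"
      by (intro integrable_continuous_real continuous_on_subset[OF continuous_paths[OF that]]) auto
    from integral_linear[OF this T] show ?thesis by (simp add: o_def)
  qed
  moreover have "integrable M (\<lambda>\<omega>. T (integral {0..t} (\<lambda>s. B s \<omega>)))"
    by (intro integrable_bounded_linear[OF T] integrable_time_integral_brownian t)
  ultimately have 2: "integrable M (\<lambda>\<omega>. integral {0..t} (\<lambda>s. T (B s \<omega>)))"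
    by (simp cong: Bochner_Integration.integrable_cong)
  have 1: "integrable M (\<lambda>\<omega>. \<sigma> *v B t \<omega>)"
    by (intro integrable_bounded_linear[OF matrix_vector_mul_bounded_linear] integrable_brownian t)
  have "integrable M (\<lambda>\<omega>. (u \<omega>, w \<omega>))"
    if "integrable M u" "integrable M w" for u :: "'w \<Rightarrow> real ^ 'n" and w :: "'w \<Rightarrow> real ^ 'a"
    using Bochner_Integration.integrable_add[OF
        integrable_bounded_linear[OF bounded_linear_Pair[OF bounded_linear_ident bounded_linear_zero] that(1)]
        integrable_bounded_linear[OF bounded_linear_Pair[OF bounded_linear_zero bounded_linear_ident] that(2)]]
    by simp
  then show ?thesis
    unfolding diffusion_def using 1 2[unfolded T_def] by auto
qed

end

section \<open>Gradients of functions on the product space\<close>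

lemma deriv_along_line:
  assumes "(f has_derivative D) (at z)"
  shows "deriv (\<lambda>h. f (z + h *\<^sub>R v)) 0 = D v" "((\<lambda>h. f (z + h *\<^sub>R v)) has_real_derivative D v) (at 0)"
proof -
  interpret bounded_linear D using assms by (rule has_derivative_bounded_linear)
  have "((\<lambda>h. f (z + h *\<^sub>R v)) has_derivative (\<lambda>h. D (h *\<^sub>R v))) (at 0)"
    by (rule has_derivative_compose[where f = "\<lambda>h. z + h *\<^sub>R v" and g = f])
      (use assms in \<open>auto intro!: derivative_eq_intros\<close>)
  then show *: "((\<lambda>h. f (z + h *\<^sub>R v)) has_real_derivative D v) (at 0)"
    by (simp add: has_field_derivative_def scaleR mult_commute_abs)
  show "deriv (\<lambda>h. f (z + h *\<^sub>R v)) 0 = D v"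
    using * by (rule DERIV_imp_deriv)
qed

lemma inner_vec_lambda_linear:
  fixes u :: "real ^ 'n"
  assumes "linear l"
  shows "(\<chi> i. l (axis i 1)) \<bullet> u = l u"
proof -
  have "l u = l (\<Sum>i\<in>UNIV. u $ i *\<^sub>R axis i 1)"
    by (simp add: basis_expansion scalar_mult_eq_scaleR[symmetric])
  also have "\<dots> = (\<Sum>i\<in>UNIV. u $ i * l (axis i 1))"
    using assms by (simp add: linear_sum linear_scale)
  finally show ?thesis by (simp add: inner_vec_def mult.commute)
qed

text \<open>
  The two partial gradients are the two blocks of the vector that represents the total derivative
  for the inner product. This identity translates between gradients and directional derivatives.
\<close>

lemma grad_inner:
  fixes f :: "(real ^ 'm0) \<times> (real ^ 'm1) \<Rightarrow> real"
  assumes "(f has_derivative D) (at z)"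
  shows "grad1 f z \<bullet> u + grad2 f z \<bullet> w = D (u, w)"
proof -
  interpret bounded_linear D using assms by (rule has_derivative_bounded_linear)
  have "grad1 f z = (\<chi> i. D (axis i 1, 0))"
    using deriv_along_line(1)[OF assms, of "(axis i 1, 0)" for i]
    by (simp add: grad1_def plus_prod_def)
  moreover have l1: "linear (\<lambda>u. D (u, 0))"
    using add[of "(b, 0)" "(c, 0)" for b c] scaleR[of _ "(b, 0)" for b] by (intro linearI) simp_all
  moreover have "grad2 f z = (\<chi> i. D (0, axis i 1))"
    using deriv_along_line(1)[OF assms, of "(0, axis i 1)" for i]
    by (simp add: grad2_def plus_prod_def)
  moreover have l2: "linear (\<lambda>w. D (0, w))"
    using add[of "(0, b)" "(0, c)" for b c] scaleR[of _ "(0, b)" for b] by (intro linearI) simp_all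
  ultimately have "grad1 f z \<bullet> u + grad2 f z \<bullet> w = D (u, 0) + D (0, w)"
    by (simp add: inner_vec_lambda_linear[OF l1] inner_vec_lambda_linear[OF l2])
  then show ?thesis by (simp flip: add)
qed

lemma derivative_norm_le_lipschitz:
  fixes f :: "'a::real_normed_vector \<Rightarrow> real"
  assumes "(f has_derivative D) (at z)" and "L-lipschitz_on UNIV f"
  shows "norm (D v) \<le> L * norm v"
proof -
  have "((\<lambda>h. (f (z + h *\<^sub>R v) - f z) / h) \<longlongrightarrow> D v) (at 0)"
    using deriv_along_line(2)[OF assms(1), of v] by (simp add: DERIV_def)
  then have "((\<lambda>h. norm ((f (z + h *\<^sub>R v) - f z) / h)) \<longlongrightarrow> norm (D v)) (at 0)"
    by (rule tendsto_norm)
  moreover have "\<forall>\<^sub>F h in at 0. norm ((f (z + h *\<^sub>R v) - f z) / h) \<le> L * norm v"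
  proof -
    have "norm ((f (z + h *\<^sub>R v) - f z) / h) \<le> L * norm v" if "h \<noteq> 0" for h
      using that lipschitz_onD[OF assms(2), of "z + h *\<^sub>R v" z]
      by (simp add: dist_norm field_simps)
    then show ?thesis by (simp add: eventually_at_filter)
  qed
  ultimately show ?thesis
    by (rule tendsto_upperbound) simp
qed

section \<open>Differentiation under the expectation\<close>

text \<open>
  The difference quotients in direction \<open>v\<close> are bounded by \<open>L * norm v\<close>, a constant and therefore
  an integrable majorant on a finite measure space, so dominated convergence applies.
\<close>

lemma (in finite_measure) has_real_derivative_expectation_translate:
  fixes f :: "'b::euclidean_space \<Rightarrow> real"
  assumes deriv: "\<And>z. (f has_derivative D z) (at z)" and L: "L-lipschitz_on UNIV f"
    and Z: "Z \<in> borel_measurable M" and int: "integrable M (\<lambda>\<omega>. f (Z \<omega>))"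
  shows "((\<lambda>h. \<integral>\<omega>. f (Z \<omega> + h *\<^sub>R v) \<partial>M) has_real_derivative (\<integral>\<omega>. D (Z \<omega>) v \<partial>M)) (at 0)"
proof -
  note [measurable] = Z
  have "continuous_on UNIV f"
    using L by (rule lipschitz_on_continuous_on)
  then have f[measurable]: "f \<in> borel_measurable borel"
    by (rule borel_measurable_continuous_onI)
  have bound: "norm (f (z + h *\<^sub>R v) - f z) \<le> L * norm v * \<bar>h\<bar>" for z h
    using lipschitz_onD[OF L, of "z + h *\<^sub>R v" z] by (simp add: dist_norm mult_ac)
  have diff: "integrable M (\<lambda>\<omega>. f (Z \<omega> + h *\<^sub>R v) - f (Z \<omega>))" for h
    by (rule integrable_const_bound[where B = "L * norm v * \<bar>h\<bar>"]) (use bound in auto)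
  have int': "integrable M (\<lambda>\<omega>. f (Z \<omega> + h *\<^sub>R v))" for h
    using Bochner_Integration.integrable_add[OF diff int] by simp
  have "(\<lambda>n. (\<integral>\<omega>. f (Z \<omega> + H n *\<^sub>R v) \<partial>M - \<integral>\<omega>. f (Z \<omega>) \<partial>M) / H n) \<longlonglongrightarrow> (\<integral>\<omega>. D (Z \<omega>) v \<partial>M)"
    if H: "\<And>n. H n \<noteq> 0" "H \<longlonglongrightarrow> 0" for H :: "nat \<Rightarrow> real"
  proof -
    have lim: "(\<lambda>n. (f (z + H n *\<^sub>R v) - f z) / H n) \<longlonglongrightarrow> D z v" for z
    proof -
      have "(\<lambda>h. (f (z + h *\<^sub>R v) - f z) / h) \<midarrow>0\<rightarrow> D z v"
        using deriv_along_line(2)[OF deriv, of z v] by (simp add: DERIV_def)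
      then show ?thesis
        using H by (auto simp: tendsto_at_iff_sequentially o_def)
    qed
    have "(\<lambda>n. \<integral>\<omega>. (f (Z \<omega> + H n *\<^sub>R v) - f (Z \<omega>)) / H n \<partial>M) \<longlonglongrightarrow> (\<integral>\<omega>. D (Z \<omega>) v \<partial>M)"
    proof (rule integral_dominated_convergence[where w = "\<lambda>_. L * norm v"])
      show "(\<lambda>\<omega>. D (Z \<omega>) v) \<in> borel_measurable M"
        by (rule borel_measurable_LIMSEQ_metric[OF _ lim]) measurable
      show "AE \<omega> in M. norm ((f (Z \<omega> + H n *\<^sub>R v) - f (Z \<omega>)) / H n) \<le> L * norm v" for n
      proof (rule AE_I2)
        fix \<omega>
        show "norm ((f (Z \<omega> + H n *\<^sub>R v) - f (Z \<omega>)) / H n) \<le> L * norm v"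
          using bound[of "Z \<omega>" "H n"] H(1)[of n] by (simp add: field_simps)
      qed
    qed (use lim in auto)
    then show ?thesis
      using int int' by simp
  qed
  then show ?thesis
    by (auto simp: DERIV_def tendsto_at_iff_sequentially o_def)
qed

section \<open>Jensen's inequality for the seminorm\<close>

lemma matrix_seminorm_square:
  "(matrix_seminorm (\<sigma> ** transpose \<sigma>) v)\<^sup>2 = (norm (transpose \<sigma> *v v))\<^sup>2"
proof -
  have "v \<bullet> (\<sigma> ** transpose \<sigma> *v v) = (transpose \<sigma> *v v) \<bullet> (transpose \<sigma> *v v)"
    by (simp add: matrix_vector_mul_assoc[symmetric] dot_lmul_matrix[symmetric])
  then show ?thesis
    by (simp add: matrix_seminorm_def power2_norm_eq_inner)
qed

text \<open>The gap between the two sides is the variance \<open>E |W - E W|\<^sup>2\<close>.\<close>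

lemma (in prob_space) norm_expectation_square_le:
  fixes W :: "'a \<Rightarrow> 'b::euclidean_space"
  assumes W: "integrable M W" and W2: "integrable M (\<lambda>\<omega>. (norm (W \<omega>))\<^sup>2)"
  shows "(norm (\<integral>\<omega>. W \<omega> \<partial>M))\<^sup>2 \<le> (\<integral>\<omega>. (norm (W \<omega>))\<^sup>2 \<partial>M)"
proof -
  define m where "m = (\<integral>\<omega>. W \<omega> \<partial>M)"
  have "0 \<le> (\<integral>\<omega>. (norm (W \<omega> - m))\<^sup>2 \<partial>M)"
    by simp
  also have "\<dots> = (\<integral>\<omega>. (norm (W \<omega>))\<^sup>2 - 2 * (W \<omega> \<bullet> m) + (norm m)\<^sup>2 \<partial>M)"
    by (simp add: power2_norm_eq_inner inner_diff_left inner_diff_right inner_commute algebra_simps)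
  also have "\<dots> = (\<integral>\<omega>. (norm (W \<omega>))\<^sup>2 \<partial>M) - 2 * (m \<bullet> m) + (norm m)\<^sup>2"
    using W W2 by (simp add: m_def prob_space)
  finally show ?thesis
    by (simp add: m_def power2_norm_eq_inner)
qed

lemma (in prob_space) matrix_seminorm_expectation_le:
  fixes V :: "'a \<Rightarrow> real ^ 'n"
  assumes [measurable]: "V \<in> borel_measurable M" and K: "\<And>\<omega>. norm (V \<omega>) \<le> K"
  shows "(matrix_seminorm (\<sigma> ** transpose \<sigma>) (\<integral>\<omega>. V \<omega> \<partial>M))\<^sup>2
    \<le> (\<integral>\<omega>. (matrix_seminorm (\<sigma> ** transpose \<sigma>) (V \<omega>))\<^sup>2 \<partial>M)"
proof -
  define W where "W \<omega> = transpose \<sigma> *v V \<omega>" for \<omega>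
  have V: "integrable M V"
    by (rule integrable_const_bound[where B = K]) (use K in auto)
  have bl: "bounded_linear ((*v) (transpose \<sigma>))"
    by (rule matrix_vector_mul_bounded_linear)
  have W: "integrable M W"
    unfolding W_def by (rule integrable_bounded_linear[OF bl V])
  note [measurable] = borel_measurable_integrable[OF W]
  obtain C where C: "\<And>v. norm (transpose \<sigma> *v v) \<le> norm v * C" "0 \<le> C"
    using bounded_linear.nonneg_bounded[OF bl] by blast
  have "norm (W \<omega>) \<le> K * C" for \<omega>
    unfolding W_def using C K[of \<omega>] by (meson mult_right_mono order_trans)
  then have "integrable M (\<lambda>\<omega>. (norm (W \<omega>))\<^sup>2)"
    by (intro integrable_const_bound[where B = "(K * C)\<^sup>2"]) (auto intro!: power_mono)
  from norm_expectation_square_le[OF W this] show ?thesis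
    unfolding matrix_seminorm_square W_def integral_bounded_linear[OF bl V] by simp
qed

section \<open>The gradient of the semigroup\<close>

lemma continuous_on_grad:
  fixes f :: "(real ^ 'm0) \<times> (real ^ 'm1) \<Rightarrow> real"
  assumes "C1_function f"
  shows "continuous_on UNIV (grad1 f)" "continuous_on UNIV (grad2 f)"
proof -
  obtain f' where f': "\<And>z. (f has_derivative blinfun_apply (f' z)) (at z)"
      and [continuous_intros]: "continuous_on UNIV f'"
    using assms by (auto simp: C1_function_def)
  have "grad1 f = (\<lambda>z. \<chi> i. f' z (axis i 1, 0))"
    using grad_inner[OF f', of _ "axis i 1" 0 for i] by (auto simp: vec_eq_iff inner_axis)
  then show "continuous_on UNIV (grad1 f)"
    by (auto intro!: continuous_intros)
  have "grad2 f = (\<lambda>z. \<chi> i. f' z (0, axis i 1))"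
    using grad_inner[OF f', of _ 0 "axis i 1" for i] by (auto simp: vec_eq_iff inner_axis)
  then show "continuous_on UNIV (grad2 f)"
    by (auto intro!: continuous_intros)
qed

lemma norm_grad_le:
  fixes f :: "(real ^ 'm0) \<times> (real ^ 'm1) \<Rightarrow> real"
  assumes f: "(f has_derivative D) (at z)" and L: "L-lipschitz_on UNIV f"
  shows "norm (grad1 f z) \<le> L" "norm (grad2 f z) \<le> L"
proof -
  have *: "norm g \<le> L" if "norm (g \<bullet> g) \<le> L * norm g" for g :: "'b::real_inner"
  proof (cases "g = 0")
    case True
    then show ?thesis using lipschitz_on_nonneg[OF L] by simp
  next
    case False
    then show ?thesis using that by (simp add: power2_norm_eq_inner[symmetric] power2_eq_square)
  qed
  show "norm (grad1 f z) \<le> L"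
    using derivative_norm_le_lipschitz[OF f L, of "(grad1 f z, 0)"] grad_inner[OF f, of "grad1 f z" 0]
    by (intro *) (simp add: norm_Pair)
  show "norm (grad2 f z) \<le> L"
    using derivative_norm_le_lipschitz[OF f L, of "(0, grad2 f z)"] grad_inner[OF f, of 0 "grad2 f z"]
    by (intro *) (simp add: norm_Pair)
qed

context std_brownian_motion
begin

text \<open>
  The position \<open>u\<close> added to the first block is carried for time \<open>t\<close> by the drift \<open>B1*\<close> into the second
  block. This is the source of the term \<open>t B1 \<nabla>2\<close> in the gradient bounds.
\<close>

lemma diffusion_translate:
  "diffusion \<sigma> B1 B (x + h *\<^sub>R (u, w)) t \<omega>
    = diffusion \<sigma> B1 B x t \<omega> + h *\<^sub>R (u, w + t *\<^sub>R (transpose B1 *v u))"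
  by (simp add: diffusion_def algebra_simps matrix_vector_mult_scaleR)

text \<open>
  The direction \<open>u\<close> in the first block is paired with \<open>\<nabla>1 f\<close> and its drifted image \<open>t B1* u\<close> with
  \<open>\<nabla>2 f\<close>; moving \<open>B1*\<close> to the other side of the inner product produces \<open>t B1 \<nabla>2 f\<close>.
\<close>

lemma grad_diffusion_semigroup:
  fixes f :: "(real ^ 'n) \<times> (real ^ 'm) \<Rightarrow> real" and B1 :: "real ^ 'm ^ 'n"
  assumes t: "0 \<le> t" and C1: "C1_function f" and L: "L-lipschitz_on UNIV f"
  shows "grad1 (diffusion_semigroup M \<sigma> B1 B t f) x
      = (\<integral>\<omega>. grad1 f (diffusion \<sigma> B1 B x t \<omega>) + t *\<^sub>R (B1 *v grad2 f (diffusion \<sigma> B1 B x t \<omega>)) \<partial>M)"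
      (is "_ = ?G")
    and "grad2 (diffusion_semigroup M \<sigma> B1 B t f) x = (\<integral>\<omega>. grad2 f (diffusion \<sigma> B1 B x t \<omega>) \<partial>M)"
      (is "_ = ?H")
    and "integrable M (\<lambda>\<omega>. grad1 f (diffusion \<sigma> B1 B x t \<omega>))"
    and "integrable M (\<lambda>\<omega>. grad2 f (diffusion \<sigma> B1 B x t \<omega>))"
proof -
  define Z where "Z = diffusion \<sigma> B1 B x t"
  obtain D where D: "\<And>z. (f has_derivative blinfun_apply (D z)) (at z)"
    using C1 by (auto simp: C1_function_def)
  have Z: "integrable M Z"
    unfolding Z_def using t by (rule integrable_diffusion)
  then have [measurable]: "Z \<in> borel_measurable M"
    by simp
  have [measurable]: "f \<in> borel_measurable borel"
      "grad1 f \<in> borel_measurable borel" "grad2 f \<in> borel_measurable borel"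
    using L C1 by (auto intro!: borel_measurable_continuous_onI lipschitz_on_continuous_on continuous_on_grad)
  have g1: "integrable M (\<lambda>\<omega>. grad1 f (Z \<omega>))" and g2: "integrable M (\<lambda>\<omega>. grad2 f (Z \<omega>))"
    by (rule integrable_const_bound[where B = L]; use norm_grad_le[OF D L] in simp)+
  then show "integrable M (\<lambda>\<omega>. grad1 f (diffusion \<sigma> B1 B x t \<omega>))"
      "integrable M (\<lambda>\<omega>. grad2 f (diffusion \<sigma> B1 B x t \<omega>))"
    by (simp_all add: Z_def)
  have fZ: "integrable M (\<lambda>\<omega>. f (Z \<omega>))"
  proof (rule Bochner_Integration.integrable_bound)
    show "integrable M (\<lambda>\<omega>. \<bar>f 0\<bar> + L * norm (Z \<omega>))"
      using Z by simp
    have "norm (f z) \<le> norm (\<bar>f 0\<bar> + L * norm z)" for z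
      using lipschitz_onD[OF L, of z 0] by (simp add: dist_norm)
    then show "AE \<omega> in M. norm (f (Z \<omega>)) \<le> norm (\<bar>f 0\<bar> + L * norm (Z \<omega>))"
      by simp
  qed measurable
  have B2: "integrable M (\<lambda>\<omega>. B1 *v grad2 f (Z \<omega>))"
    by (rule integrable_bounded_linear[OF matrix_vector_mul_bounded_linear g2])
  have deriv: "((\<lambda>h. diffusion_semigroup M \<sigma> B1 B t f (x + h *\<^sub>R (u, w)))
      has_real_derivative ?G \<bullet> u + ?H \<bullet> w) (at 0)" for u w
  proof -
    have "D z (u, w + t *\<^sub>R (transpose B1 *v u))
        = (grad1 f z + t *\<^sub>R (B1 *v grad2 f z)) \<bullet> u + grad2 f z \<bullet> w" for z
      unfolding grad_inner[OF D, symmetric]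
      by (simp add: inner_add_left inner_add_right dot_lmul_matrix[symmetric] inner_commute)
    then have "(\<integral>\<omega>. D (Z \<omega>) (u, w + t *\<^sub>R (transpose B1 *v u)) \<partial>M) = ?G \<bullet> u + ?H \<bullet> w"
      using g1 g2 B2 by (simp add: Z_def)
    with has_real_derivative_expectation_translate[OF D L _ fZ, of "(u, w + t *\<^sub>R (transpose B1 *v u))"]
    show ?thesis
      unfolding diffusion_semigroup_def diffusion_translate Z_def[symmetric] by simp
  qed
  show "grad1 (diffusion_semigroup M \<sigma> B1 B t f) x = ?G"
    using DERIV_imp_deriv[OF deriv, of "axis i 1" 0 for i]
    by (simp add: grad1_def vec_eq_iff plus_prod_def inner_axis)
  show "grad2 (diffusion_semigroup M \<sigma> B1 B t f) x = ?H"
    using DERIV_imp_deriv[OF deriv, of 0 "axis i 1" for i]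
    by (simp add: grad2_def vec_eq_iff plus_prod_def inner_axis)
qed

end

theorem corollary2p3:
  fixes \<sigma> A0 :: "real ^ 'm0 ^ 'm0"
    and B1 :: "real ^ 'm1 ^ 'm0"
    and M :: "'w measure"
    and B :: "real \<Rightarrow> 'w \<Rightarrow> real ^ 'm0"
    and f :: "(real ^ 'm0) \<times> (real ^ 'm1) \<Rightarrow> real"
    and t :: real
    and x1 :: "real ^ 'm0"
    and x2 :: "real ^ 'm1"
  assumes "CARD('m1) \<le> CARD('m0)"
    and "A0 = \<sigma> ** transpose \<sigma>"
    and "transpose A0 = A0"
    and "\<forall>v. 0 \<le> v \<bullet> (A0 *v v)"
    and "rank B1 = CARD('m1)"
    and "std_brownian_motion M B"
    and "C1_function f"
    and "\<exists>L. L-lipschitz_on UNIV f"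
    and "0 \<le> t"
  defines "P \<equiv> diffusion_semigroup M \<sigma> B1 B"
  shows "2 * carre_du_champ A0 (P t f) (x1, x2)
           \<le> P t (\<lambda>z. (matrix_seminorm A0 (grad1 f z + t *\<^sub>R (B1 *v grad2 f z)))\<^sup>2) (x1, x2)
       \<and> 2 * P t (carre_du_champ A0 f) (x1, x2)
           \<ge> (matrix_seminorm A0
                (grad1 (P t f) (x1, x2) - t *\<^sub>R (B1 *v grad2 (P t f) (x1, x2))))\<^sup>2"
proof -
  interpret std_brownian_motion M B by fact
  obtain L where L: "L-lipschitz_on UNIV f"
    using assms by blast
  obtain D where D: "\<And>z. (f has_derivative blinfun_apply (D z)) (at z)"
    using \<open>C1_function f\<close> by (auto simp: C1_function_def)
  define Z where "Z = diffusion \<sigma> B1 B (x1, x2) t"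
  define V where "V \<omega> = grad1 f (Z \<omega>) + t *\<^sub>R (B1 *v grad2 f (Z \<omega>))" for \<omega>
  note grad = grad_diffusion_semigroup[OF \<open>0 \<le> t\<close> \<open>C1_function f\<close> L, of \<sigma> B1 "(x1, x2)",
      folded P_def Z_def]
  have B2: "integrable M (\<lambda>\<omega>. B1 *v grad2 f (Z \<omega>))"
    by (rule integrable_bounded_linear[OF matrix_vector_mul_bounded_linear grad(4)])
  obtain C where C: "0 \<le> C" "\<And>v. norm (B1 *v v) \<le> norm v * C"
    using bounded_linear.nonneg_bounded[OF matrix_vector_mul_bounded_linear[of B1]] by blast
  have V_le: "norm (V \<omega>) \<le> L + t * (L * C)" for \<omega>
  proof -
    have "norm (B1 *v grad2 f (Z \<omega>)) \<le> L * C"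
      using C norm_grad_le(2)[OF D L, of "Z \<omega>"] by (meson mult_right_mono order_trans)
    then have "norm (t *\<^sub>R (B1 *v grad2 f (Z \<omega>))) \<le> t * (L * C)"
      using \<open>0 \<le> t\<close> by (simp add: mult_left_mono)
    then show ?thesis
      unfolding V_def by (intro norm_triangle_le add_mono norm_grad_le(1)[OF D L])
  qed
  have "(matrix_seminorm A0 (grad1 (P t f) (x1, x2)))\<^sup>2 \<le> (\<integral>\<omega>. (matrix_seminorm A0 (V \<omega>))\<^sup>2 \<partial>M)"
    unfolding grad(1) V_def[symmetric] \<open>A0 = \<sigma> ** transpose \<sigma>\<close>
    using grad(3) B2 by (intro matrix_seminorm_expectation_le[OF _ V_le]) (simp add: V_def[abs_def])
  moreover
  have "grad1 (P t f) (x1, x2) - t *\<^sub>R (B1 *v grad2 (P t f) (x1, x2)) = (\<integral>\<omega>. grad1 f (Z \<omega>) \<partial>M)"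
    unfolding grad(1,2) using grad(3) B2
    by (simp add: integral_bounded_linear[OF matrix_vector_mul_bounded_linear grad(4)])
  then have "(matrix_seminorm A0 (grad1 (P t f) (x1, x2) - t *\<^sub>R (B1 *v grad2 (P t f) (x1, x2))))\<^sup>2
      \<le> (\<integral>\<omega>. (matrix_seminorm A0 (grad1 f (Z \<omega>)))\<^sup>2 \<partial>M)"
    using matrix_seminorm_expectation_le[OF borel_measurable_integrable[OF grad(3)]
        norm_grad_le(1)[OF D L], of \<sigma>] \<open>A0 = \<sigma> ** transpose \<sigma>\<close> by simp
  ultimately show ?thesis
    by (simp add: P_def diffusion_semigroup_def carre_du_champ_def V_def Z_def)
qed

end
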